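(* Let $\varphi:S^1\to S^1$ be an orientation preserving homeomorphism with irrational rotation number $\varrho$ and $\Phi:\mathbb{R}\to\mathbb{R}$ its lift. (1) If $\varphi$ is transitive, then for every $z\in S^1$ the sequence $\eta_n(z)$, $n\in\mathbb{N}$, is dense in the interval $$\Big[\min_{x\in[0,1]}\{\Phi(x)-x \bmod 1\},\ \max_{x\in[0,1]}\{\Phi(x)-x\bmod 1\}\Big],$$ which can be rewritten in the form $$\Big[\min_{x\in[0,1]}\{\Gamma^{-1}(x+\varrho)-\Gamma^{-1}(x)\bmod 1\},\ \max_{x\in[0,1]}\{\Gamma^{-1}(x+\varrho)-\Gamma^{-1}(x)\bmod 1\}\Big],$$ where $\Gamma$ is a lift of a homeomorphism $\gamma$ conjugating $\varphi$ to the rotation $r_\varrho$, i.e. $\varphi=\gamma^{-1}\circ r_\varrho\circ\gamma$. (2) If $\varphi$ is not transitive, then i) for $z\in\Delta$ the sequence $\eta_n(z)$ is dense in the set $\mathcal{D}:=\{\Phi(x)-x\bmod 1:\ x\in\widetilde\Delta_0\}$; ii) for $z\in S^1\setminus\Delta$ and $w\in\Delta$ there exist increasing sequences $\{n_k\}$ and $\{\widehat n_k\}$ such that for every $l\in\mathbb{Z}$ $$\lim_{k\to\infty}\eta_l(\varphi^{n_k}(z))=\eta_l(w)\quad\text{and}\quad \lim_{k\to\infty}\eta_l(\varphi^{-\widehat n_k}(z))=\eta_l(w).$$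
   Context: $S^1$ is the unit circle, covered by $\mathbb{R}$ via $x\mapsto\exp(2\pi\mathrm{i}x)$. The rotation number is $\varrho(\varphi)=\lim_{n\to\infty}\Phi^n(x)/n\bmod 1$. The displacement sequence of $z=\exp(2\pi\mathrm{i}x)$ is $\eta_n(z)=\Phi^n(x)-\Phi^{n-1}(x)\bmod 1\in[0,1)$ ($n\in\mathbb{Z}$), independent of the choice of lift. $r_\varrho$ is the rotation $z\mapsto z\exp(2\pi\mathrm{i}\varrho)$. If $\varphi$ (with irrational rotation number) is not transitive, $\Delta\subset S^1$ denotes its unique minimal set (a Cantor type set) and $\widetilde\Delta_0\subset[0,1)$ the lift of $\Delta$ to $[0,1)$, i.e. the set of $x\in[0,1)$ with $\exp(2\pi\mathrm{i}x)\in\Delta$. If $\varphi$ is transitive it is conjugated to $r_\varrho$. *)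

theory Defs
  imports "HOL-Analysis.Analysis"
begin

abbreviation circle :: "complex set"
  where "circle \<equiv> sphere 0 1"

definition cover :: "real \<Rightarrow> complex"
  where "cover x = exp (2 * complex_of_real pi * \<i> * complex_of_real x)"

text \<open>Circle maps are functions on \<^typ>\<open>complex\<close> of which only the values on the circle matter.\<close>

definition circle_homeo :: "(complex \<Rightarrow> complex) \<Rightarrow> bool"
  where "circle_homeo f \<longleftrightarrow> (\<exists>g. homeomorphism circle circle f g)"

definition circle_lift :: "(complex \<Rightarrow> complex) \<Rightarrow> (real \<Rightarrow> real) \<Rightarrow> bool"
  where "circle_lift f F \<longleftrightarrow> continuous_on UNIV F \<and> (\<forall>x. cover (F x) = f (cover x))"

text \<open>Any two lifts differ by an integer constant, so if one lift is increasing then all are.\<close>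

definition orientation_preserving_homeo :: "(complex \<Rightarrow> complex) \<Rightarrow> bool"
  where "orientation_preserving_homeo f \<longleftrightarrow>
    circle_homeo f \<and> (\<exists>F. circle_lift f F \<and> strict_mono F)"

definition rotation :: "real \<Rightarrow> complex \<Rightarrow> complex"
  where "rotation \<rho> z = z * cover \<rho>"

text \<open>The value \<open>lim F\<^sup>n(x)/n mod 1\<close>, represented in \<open>[0,1)\<close>. By Poincare's theorem it exists and
  depends neither on the lift \<open>F\<close> nor on \<open>x\<close> when \<open>f\<close> is an orientation preserving homeomorphism.\<close>

definition rotation_number :: "(complex \<Rightarrow> complex) \<Rightarrow> real"
  where "rotation_number f =
    (THE r. \<forall>F x. circle_lift f F \<longrightarrow>
       (\<exists>L. (\<lambda>n. (F ^^ n) x / real n) \<longlonglongrightarrow> L \<and> r = frac L))"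

text \<open>Iterates with integer exponent of a bijection \<open>f\<close> of \<open>A\<close> onto itself.\<close>

definition ziter :: "'a set \<Rightarrow> ('a \<Rightarrow> 'a) \<Rightarrow> int \<Rightarrow> 'a \<Rightarrow> 'a"
  where "ziter A f k = (if 0 \<le> k then f ^^ nat k else inv_into A f ^^ nat (- k))"

text \<open>\<open>\<eta>\<^sub>n(z)\<close> computed from a lift \<open>F\<close>. The point \<open>Arg2pi z / (2 * pi)\<close> is the representative
  in \<open>[0,1)\<close> of \<open>z\<close>; any other representative gives the same value, since
  \<open>F (x + 1) = F x + 1\<close>.\<close>

definition displacement :: "(real \<Rightarrow> real) \<Rightarrow> int \<Rightarrow> complex \<Rightarrow> real"
  where "displacement F n z =
    (let x = Arg2pi z / (2 * pi) in frac (ziter UNIV F n x - ziter UNIV F (n - 1) x))"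

definition circle_transitive :: "(complex \<Rightarrow> complex) \<Rightarrow> bool"
  where "circle_transitive f \<longleftrightarrow>
    (\<exists>z\<in>circle. circle \<subseteq> closure (range (\<lambda>k. ziter circle f k z)))"

definition closed_invariant :: "(complex \<Rightarrow> complex) \<Rightarrow> complex set \<Rightarrow> bool"
  where "closed_invariant f A \<longleftrightarrow> A \<noteq> {} \<and> A \<subseteq> circle \<and> closed A \<and> f ` A = A"

definition minimal_set :: "(complex \<Rightarrow> complex) \<Rightarrow> complex set \<Rightarrow> bool"
  where "minimal_set f A \<longleftrightarrow>
    closed_invariant f A \<and> (\<forall>B. closed_invariant f B \<and> B \<subseteq> A \<longrightarrow> B = A)"

definition lift01 :: "complex set \<Rightarrow> real set"
  where "lift01 A = {x \<in> {0..<1}. cover x \<in> A}"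

definition dense_in_set :: "'a::topological_space set \<Rightarrow> 'a set \<Rightarrow> bool"
  where "dense_in_set A B \<longleftrightarrow> A \<subseteq> B \<and> B \<subseteq> closure A"

text \<open>\<open>LEAST\<close> and \<open>GREATEST\<close> are genuine (attained) extrema, as opposed to \<^const>\<open>Inf\<close> and
  \<^const>\<open>Sup\<close>; \<^const>\<open>Min\<close> and \<^const>\<open>Max\<close> are restricted to finite sets.\<close>

definition min_max_interval :: "(real \<Rightarrow> real) \<Rightarrow> real set"
  where "min_max_interval h = {(LEAST y. y \<in> h ` {0..1}) .. (GREATEST y. y \<in> h ` {0..1})}"

definition conjugates_to_rotation :: "(complex \<Rightarrow> complex) \<Rightarrow> (complex \<Rightarrow> complex) \<Rightarrow> real \<Rightarrow> bool"
  where "conjugates_to_rotation g f \<rho> \<longleftrightarrow>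
    circle_homeo g \<and> (\<forall>z\<in>circle. f z = inv_into circle g (rotation \<rho> (g z)))"

end

theory Submission
  imports Defs "HOL-Analysis.Kronecker_Approximation_Theorem"
begin

text \<open>
  Write \<open>F\<close> for the lift and \<open>\<tau>\<close> for its translation number \<open>lim F\<^sup>n(x)/n\<close>, a representative of
  the rotation number. Since \<open>\<tau>\<close> is irrational, the points \<open>F\<^sup>n(0) + m\<close> with integers \<open>n\<close>, \<open>m\<close> are
  ordered on the line exactly like the numbers \<open>n\<tau> + m\<close>. Sending the former to the latter and
  extending by suprema gives a monotone map \<open>\<Gamma>\<close> with \<open>\<Gamma>(F\<^sup>n(x) + m) = \<Gamma>(x) + n\<tau> + m\<close>: Poincare's
  semiconjugacy to the translation by \<open>\<tau>\<close> (\<open>semiconj_iter\<close>). A monotone map has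
  no jumps when its range is dense, so \<open>\<Gamma>\<close> is also continuous.

  The two cases of the theorem differ only in how much \<open>\<Gamma>\<close> collapses, and both rest on one fact
  (\<open>orbit_accumulates\<close>). Suppose that \<open>\<Gamma>\<close> is not constant near \<open>v\<close>, so that \<open>\<Gamma> a < \<Gamma> b\<close> for
  some \<open>a\<close>, \<open>b\<close> close to \<open>v\<close>. By Kronecker's theorem, each forward and each backward orbit
  has, at arbitrarily late times, a value of \<open>\<Gamma>\<close> in the interval from \<open>\<Gamma> a\<close> to \<open>\<Gamma> b\<close> modulo \<open>1\<close>, and
  monotonicity then places the orbit point itself between \<open>a\<close> and \<open>b\<close>. Hence every orbit approaches
  \<open>v\<close> modulo \<open>1\<close>, in both time directions. As \<open>\<eta>\<^sub>n(z)\<close> is a continuous function of \<open>z\<close> and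
  \<open>\<eta>\<^sub>n(z) = \<eta>\<^sub>1(\<phi>\<^sup>n\<^sup>-\<^sup>1(z))\<close>, convergence of the displacements follows.

  In the transitive case a dense orbit meets each interval in two points, and \<open>\<Gamma>\<close> separates these; so
  \<open>\<Gamma>\<close> is strictly increasing, is nowhere locally constant, and descends to a conjugacy. For a
  minimal set \<open>\<Delta>\<close>, each \<open>w \<in> \<Delta>\<close> belongs to its own \<open>\<omega>\<close>-limit set; so near a lift \<open>v\<close> of \<open>w\<close> there are
  both \<open>v\<close> and a later point of its orbit, where \<open>\<Gamma>\<close> takes another value.

  Finally, the displacement \<open>F x - x\<close> never is an integer, hence has a continuous reduction modulo
  \<open>1\<close>, whose range over one period is a compact interval. Any conjugacy to the rotation
  turns it into the displacement computed in the new coordinate, point by point; so the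
  two intervals in the transitive case are the same set of values.
\<close>

section \<open>The covering of the circle\<close>

lemma cover_add: "cover (x + y) = cover x * cover y"
  by (simp add: cover_def exp_add algebra_simps)

lemma cover_eq_iff: "cover x = cover y \<longleftrightarrow> (\<exists>k::int. x = y + of_int k)"
proof -
  have "2 * complex_of_real pi * \<i> * complex_of_real x
      = 2 * complex_of_real pi * \<i> * complex_of_real y + (of_int (2 * n) * pi) * \<i>
    \<longleftrightarrow> x = y + of_int n" (is "?l \<longleftrightarrow> ?r") for n :: int
  proof -
    have "?l \<longleftrightarrow> (2 * pi) * x = (2 * pi) * (y + of_int n)"
      by (simp add: complex_eq_iff ring_distribs mult_ac)
    then show ?thesis by simp
  qed
  then show ?thesis
    unfolding cover_def exp_eq by presburger
qed

lemma cover_add_of_int [simp]: "cover (x + of_int k) = cover x"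
  using cover_eq_iff by blast

lemma norm_cover [simp]: "norm (cover x) = 1"
  unfolding cover_def by simp

lemma cover_in_circle [simp]: "cover x \<in> circle"
  by simp

lemma cover_Arg2pi:
  assumes "z \<in> circle"
  shows "cover (Arg2pi z / (2 * pi)) = z"
proof -
  have "cover (Arg2pi z / (2 * pi)) = exp (\<i> * of_real (Arg2pi z))"
    unfolding cover_def by (rule arg_cong[of _ _ exp]) simp
  then show ?thesis
    using assms complex_norm_eq_1_exp by auto
qed

lemma circle_eq_range_cover: "circle = range cover"
proof
  show "circle \<subseteq> range cover"
    by (metis cover_Arg2pi rangeI subsetI)
qed auto

lemma circle_coverE:
  assumes "z \<in> circle"
  obtains x where "z = cover x"
  using assms unfolding circle_eq_range_cover by blast

lemma continuous_on_cover [continuous_intros]: 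
  "continuous_on S f \<Longrightarrow> continuous_on S (\<lambda>x. cover (f x))"
  unfolding cover_def by (intro continuous_intros)

lemma cover_image_unit_interval: "cover ` {0..<1} = circle"
proof -
  have "cover x \<in> cover ` {0..<1}" for x
    by (rule image_eqI[of _ _ "frac x"])
      (auto simp: frac_lt_1 cover_eq_iff intro!: exI[of _ "\<lfloor>x\<rfloor>"], simp add: frac_def)
  then show ?thesis
    unfolding circle_eq_range_cover by blast
qed

text \<open>
  Nearby points of the circle have nearby representatives: a difference that is reduced to
  \<open>[-1/2, 1/2]\<close> and bounded away from \<open>0\<close> lies in a compact set that contains no integer.
\<close>
lemma close_representatives:
  assumes "\<epsilon> > 0"
  obtains \<delta> where "\<delta> > 0"
    "\<And>a b. dist (cover a) (cover b) < \<delta> \<Longrightarrow> \<exists>m::int. \<bar>a + of_int m - b\<bar> < \<epsilon>"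
proof -
  define K where "K = {d::real. \<epsilon> \<le> \<bar>d\<bar>} \<inter> {-1/2..1/2}"
  have K: "compact K"
    unfolding K_def by (intro closed_Int_compact closed_Collect_le continuous_intros compact_Icc)
  have nz: "norm (cover d - 1) > 0" if "d \<in> K" for d
  proof -
    have "cover d \<noteq> cover 0"
    proof
      assume "cover d = cover 0"
      then obtain k :: int where "d = of_int k"
        using cover_eq_iff[of d 0] by auto
      with that assms show False
        unfolding K_def by (cases "k = 0") (auto simp: abs_if)
    qed
    then show ?thesis by (simp add: cover_def)
  qed
  obtain \<delta> where \<delta>: "\<delta> > 0" "\<And>d. d \<in> K \<Longrightarrow> \<delta> \<le> norm (cover d - 1)"
  proof (cases "K = {}")
    case True
    then show ?thesis using that[of 1] by simp
  next
    case False
    have "continuous_on K (\<lambda>d. norm (cover d - 1))"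
      by (intro continuous_intros)
    from continuous_attains_inf[OF K False this] show ?thesis
      using nz that by metis
  qed
  show thesis
  proof (rule that[OF \<delta>(1)])
    fix a b assume *: "dist (cover a) (cover b) < \<delta>"
    define d where "d = a - b - of_int (round (a - b))"
    have "cover a = cover b * cover d"
      using cover_add_of_int[of a "- round (a - b)"] by (simp add: d_def flip: cover_add)
    then have "cover a - cover b = cover b * (cover d - 1)"
      by (simp add: algebra_simps)
    then have "norm (cover d - 1) < \<delta>"
      using * by (simp add: dist_norm norm_mult)
    then have "d \<notin> K"
      using \<delta>(2) by force
    moreover have "\<bar>d\<bar> \<le> 1/2"
      using of_int_round_abs_le[of "a - b"] unfolding d_def by linarith
    ultimately have "\<bar>d\<bar> < \<epsilon>"
      unfolding K_def by auto
    then show "\<exists>m::int. \<bar>a + of_int m - b\<bar> < \<epsilon>"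
      unfolding d_def by (intro exI[of _ "- round (a - b)"]) (simp add: algebra_simps)
  qed
qed

section \<open>Integer iterates\<close>

lemma ziter_0 [simp]: "ziter A f 0 x = x"
  by (simp add: ziter_def)

lemma ziter_of_nat: "ziter A f (int n) x = (f ^^ n) x"
  by (simp add: ziter_def)

lemma ziter_in:
  assumes "bij_betw f A A" "x \<in> A"
  shows "ziter A f k x \<in> A"
proof -
  have "(g ^^ n) x \<in> A" if "g ` A \<subseteq> A" for g n
    by (induction n) (use that assms(2) in auto)
  moreover have "inv_into A f ` A \<subseteq> A" "f ` A \<subseteq> A"
    using assms(1) bij_betw_inv_into[OF assms(1)] by (simp_all add: bij_betw_imp_surj_on)
  ultimately show ?thesis
    unfolding ziter_def by auto
qed

lemma ziter_plus_1:
  assumes "bij_betw f A A" "x \<in> A"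
  shows "ziter A f (k + 1) x = f (ziter A f k x)"
proof (cases "k \<ge> 0")
  case True
  then show ?thesis
    by (simp add: ziter_def nat_add_distrib)
next
  case False
  define n where "n = nat (- k - 1)"
  have k: "k = - int (Suc n)"
    using False by (simp add: n_def)
  have "ziter A f (- int n) x \<in> A"
    by (rule ziter_in[OF assms])
  then have "(inv_into A f ^^ n) x \<in> A"
    by (auto simp: ziter_def split: if_splits)
  moreover have "ziter A f k x = inv_into A f ((inv_into A f ^^ n) x)"
    unfolding k ziter_def by (simp del: of_nat_Suc)
  moreover have "ziter A f (k + 1) x = (inv_into A f ^^ n) x"
    unfolding k ziter_def by simp
  ultimately show ?thesis
    using assms(1) by (simp add: f_inv_into_f bij_betw_def)
qed

lemma ziter_minus_1:
  assumes "bij_betw f A A" "x \<in> A"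
  shows "ziter A f (k - 1) x = inv_into A f (ziter A f k x)"
  using ziter_plus_1[OF assms, of "k - 1"] ziter_in[OF assms, of "k - 1"] assms(1)
  by (simp add: bij_betw_def)

lemma int_step_induct [case_names 0 plus minus]:
  fixes k :: int
  assumes "P 0" "\<And>k. P k \<Longrightarrow> P (k + 1)" "\<And>k. P k \<Longrightarrow> P (k - 1)"
  shows "P k"
  using assms by (induction k rule: int_induct[of _ 0]) auto

lemma ziter_add:
  assumes "bij_betw f A A" "x \<in> A"
  shows "ziter A f (j + k) x = ziter A f j (ziter A f k x)"
proof (induction j rule: int_step_induct)
  case (plus j)
  then show ?case
    using ziter_plus_1[OF assms, of "j + k"] ziter_plus_1[OF assms(1) ziter_in[OF assms]]
    by (metis add.assoc add.commute)
next
  case (minus j)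
  then show ?case
    using ziter_minus_1[OF assms, of "j + k"] ziter_minus_1[OF assms(1) ziter_in[OF assms]]
    by (metis add.commute add_diff_eq)
qed simp

lemma ziter_semiconj:
  assumes f: "bij_betw f A A" and g: "bij_betw g B B"
    and c: "c ` A \<subseteq> B" "\<And>x. x \<in> A \<Longrightarrow> c (f x) = g (c x)" and x: "x \<in> A"
  shows "c (ziter A f k x) = ziter B g k (c x)"
proof -
  have cx: "c x \<in> B" using c x by auto
  show ?thesis
  proof (induction k rule: int_step_induct)
    case (plus k)
    then show ?case
      using ziter_plus_1[OF f x] ziter_plus_1[OF g cx] ziter_in[OF f x] c(2) by metis
  next
    case (minus k)
    have "g (c (ziter A f (k - 1) x)) = g (ziter B g (k - 1) (c x))"
      using ziter_plus_1[OF f x, of "k - 1"] ziter_plus_1[OF g cx, of "k - 1"]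
        ziter_in[OF f x, of "k - 1"] c(2) minus by simp
    then show ?case
      using g c(1) ziter_in[OF f x, of "k - 1"] ziter_in[OF g cx, of "k - 1"]
      unfolding bij_betw_def inj_on_def by blast
  qed simp
qed

section \<open>Lifts of circle maps\<close>

text \<open>The difference of two lifts is continuous with integer values.\<close>
lemma lift_unique:
  assumes "circle_lift f F" "circle_lift f G"
  obtains k :: int where "\<And>x. G x = F x + of_int k"
proof -
  define d where "d = (\<lambda>x. G x - F x)"
  have int: "\<exists>k::int. d x = of_int k" for x
    using assms cover_eq_iff[of "G x" "F x"] unfolding d_def circle_lift_def by fastforce
  have "d constant_on UNIV"
  proof (rule continuous_discrete_range_constant)
    show "continuous_on UNIV d"
      using assms unfolding d_def circle_lift_def by (intro continuous_intros) auto
    show "\<exists>e>0. \<forall>y. y \<in> UNIV \<and> d y \<noteq> d x \<longrightarrow> e \<le> norm (d y - d x)" for x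
    proof (intro exI[of _ 1] conjI allI impI)
      fix y assume "y \<in> UNIV \<and> d y \<noteq> d x"
      moreover obtain i j :: int where "d x = of_int i" "d y = of_int j"
        using int by meson
      ultimately show "1 \<le> norm (d y - d x)"
        by (simp flip: of_int_diff)
    qed simp
  qed simp
  then obtain c where "\<And>x. d x = c"
    unfolding constant_on_def by blast
  with int obtain k :: int where "\<And>x. d x = of_int k"
    by metis
  then show thesis
    using that unfolding d_def by (metis diff_add_cancel add.commute)
qed

text \<open>Precomposing a lift with \<open>x \<mapsto> x + 1\<close> gives another lift of the same map.\<close>
lemma lift_degree:
  assumes "circle_lift f F"
  obtains k :: int where "\<And>x. F (x + 1) = F x + of_int k"
proof -
  have "continuous_on UNIV (\<lambda>x. F (x + 1))"
    using assms unfolding circle_lift_def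
    by (intro continuous_on_compose2[of UNIV F UNIV "\<lambda>x. x + 1"] continuous_on_add
        continuous_on_id continuous_on_const) auto
  moreover have "cover (F (x + 1)) = f (cover x)" for x
    using assms cover_add_of_int[of x 1] unfolding circle_lift_def by simp
  ultimately have "circle_lift f (\<lambda>x. F (x + 1))"
    unfolding circle_lift_def by blast
  from lift_unique[OF assms this] obtain k :: int where "\<And>x. F (x + 1) = F x + of_int k"
    by metis
  then show thesis by (rule that)
qed

lemma shift_by_int:
  fixes F :: "real \<Rightarrow> real"
  assumes "\<And>x. F (x + 1) = F x + c"
  shows "F (x + of_int n) = F x + of_int n * c"
proof (induction n rule: int_step_induct)
  case (plus n)
  then show ?case using assms[of "x + of_int n"] by (simp add: algebra_simps)
next
  case (minus n)
  then show ?case using assms[of "x + of_int (n - 1)"] by (simp add: algebra_simps)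
qed simp

text \<open>
  Were the degree of an injective map at least \<open>2\<close> in modulus, a lift would increase by \<open>1\<close>
  already strictly inside a period, and the map would take the same value twice.
\<close>
lemma degree_of_injective:
  assumes "circle_lift f F" "inj_on f circle" "\<And>x. F (x + 1) = F x + of_int k" "k \<noteq> 0"
  shows "\<bar>k\<bar> = 1"
proof (rule ccontr)
  assume "\<bar>k\<bar> \<noteq> 1"
  with \<open>k \<noteq> 0\<close> have k: "k \<ge> 2 \<or> k \<le> -2" by linarith
  have "continuous_on {0..1} F"
    using assms(1) unfolding circle_lift_def by (blast intro: continuous_on_subset)
  then obtain c d where cd: "F ` {0..1} = {c..d}"
    using continuous_image_closed_interval[of 0 1 F] by auto
  have F1: "F 1 = F 0 + of_int k"
    using assms(3)[of 0] by simp
  have "F 0 \<in> {c..d}" "F 1 \<in> {c..d}"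
    unfolding cd[symmetric] by auto
  moreover have "real_of_int k \<ge> 2 \<or> real_of_int k \<le> - 2"
    using k by linarith
  ultimately have "F 0 + sgn (of_int k) \<in> {c..d}"
    using F1 by (auto simp: sgn_if)
  then obtain y where y: "y \<in> {0..1}" "F y = F 0 + sgn (of_int k)"
    unfolding cd[symmetric] by (metis imageE)
  have "y \<noteq> 0" "y \<noteq> 1"
    using y F1 k \<open>k \<noteq> 0\<close> by (auto simp: sgn_if split: if_splits)
  have "cover (F y) = cover (F 0)"
    unfolding y(2) cover_eq_iff by (intro exI[of _ "sgn k"]) (simp add: sgn_if)
  then have "f (cover y) = f (cover 0)"
    using assms(1) unfolding circle_lift_def by simp
  then have "cover y = cover 0"
    using assms(2) unfolding inj_on_def by simp
  then obtain i :: int where "y = of_int i"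
    using cover_eq_iff[of y 0] by auto
  with y(1) \<open>y \<noteq> 0\<close> \<open>y \<noteq> 1\<close> show False by auto
qed

lemma inj_lift:
  assumes "circle_lift f F" "inj_on f circle" "\<And>x. F (x + 1) = F x + of_int k" "k \<noteq> 0"
  shows "inj F"
proof (rule injI)
  fix x y assume eq: "F x = F y"
  then have "f (cover x) = f (cover y)"
    using assms(1) unfolding circle_lift_def by metis
  then have "cover x = cover y"
    using assms(2) unfolding inj_on_def by simp
  then obtain i :: int where i: "x = y + of_int i"
    using cover_eq_iff by auto
  with shift_by_int[of F "of_int k" y i] assms(3) eq \<open>k \<noteq> 0\<close> show "x = y" by simp
qed

text \<open>The values at the integers are unbounded in both directions.\<close>
lemma surj_of_unit_shift:
  fixes F :: "real \<Rightarrow> real"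
  assumes "continuous_on UNIV F" "\<And>x. F (x + 1) = F x + of_int k" "\<bar>k\<bar> = 1"
  shows "surj F"
proof -
  have sh: "F (of_int n) = F 0 + of_int n * of_int k" for n
    using shift_by_int[of F "of_int k" 0 n] assms(2) by simp
  have "y \<in> range F" for y
  proof -
    define n where "n = \<lceil>\<bar>y - F 0\<bar>\<rceil>"
    have n: "n \<ge> 0" "\<bar>y - F 0\<bar> \<le> of_int n"
      unfolding n_def by linarith+
    have "continuous_on {of_int (- n)..of_int n} F"
      using assms(1) by (blast intro: continuous_on_subset)
    then obtain c d where cd: "F ` {of_int (- n)..of_int n} = {c..d}"
      using continuous_image_closed_interval[of "of_int (- n)" "of_int n" F] n by auto
    have "F (of_int (- n)) \<in> {c..d}" "F (of_int n) \<in> {c..d}"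
      unfolding cd[symmetric] using n by auto
    moreover have "k = 1 \<or> k = -1" using assms(3) by linarith
    ultimately have "y \<in> {c..d}"
      using n sh[of n] sh[of "- n"] by auto
    then show ?thesis unfolding cd[symmetric] by auto
  qed
  then show ?thesis by auto
qed

section \<open>The translation number of a degree one homeomorphism of the line\<close>

locale degree_one_homeo =
  fixes F :: "real \<Rightarrow> real"
  assumes cont: "continuous_on UNIV F"
    and mono: "strict_mono F"
    and shift: "F (x + 1) = F x + 1"
begin

abbreviation iter :: "int \<Rightarrow> real \<Rightarrow> real"
  where "iter \<equiv> ziter UNIV F"

lemma bij: "bij F"
  using surj_of_unit_shift[OF cont, of 1] shift strict_mono_imp_inj_on[OF mono]
  by (simp add: bij_def)

lemma iter_add: "iter (j + k) x = iter j (iter k x)"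
  using ziter_add[OF bij] by simp

lemma iter_plus_1: "iter (k + 1) x = F (iter k x)"
  using ziter_plus_1[OF bij] by simp

lemma iter_minus_1: "F (iter (k - 1) x) = iter k x"
  using iter_plus_1[of "k - 1" x] by simp

lemma less_iff: "F x < F y \<longleftrightarrow> x < y"
  using mono strict_mono_less by blast

lemma iter_less_iff [simp]: "iter k x < iter k y \<longleftrightarrow> x < y"
proof (induction k rule: int_step_induct)
  case (plus k)
  then show ?case by (simp add: iter_plus_1 less_iff)
next
  case (minus k)
  then show ?case using less_iff[of "iter (k - 1) x" "iter (k - 1) y"] by (simp add: iter_minus_1)
qed simp

lemma iter_le_iff [simp]: "iter k x \<le> iter k y \<longleftrightarrow> x \<le> y"
  by (simp flip: not_less)

lemma iter_shift: "iter k (x + of_int m) = iter k x + of_int m"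
proof (induction k rule: int_step_induct)
  case (plus k)
  then show ?case
    using shift_by_int[of F 1 "iter k x" m, OF shift] by (simp add: iter_plus_1)
next
  case (minus k)
  have "F (iter (k - 1) (x + of_int m)) = F (iter (k - 1) x + of_int m)"
    using minus shift_by_int[of F 1 "iter (k - 1) x" m, OF shift] by (simp add: iter_minus_1)
  then show ?case
    using bij by (simp add: bij_def inj_eq)
qed simp

lemma continuous_on_iter: "continuous_on UNIV (iter k)"
proof (rule continuous_onI_mono)
  have "iter k (iter (- k) y) = y" for y
    by (simp flip: iter_add)
  then have "range (iter k) = UNIV"
    by (metis surjI)
  then show "open (range (iter k))"
    by simp
qed simp

text \<open>
  Modulo integers, \<open>x\<close> lies in the period \<open>[y, y + 1]\<close>, which a monotone map that commutes with
  \<open>x \<mapsto> x + 1\<close> carries to a period again.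
\<close>
lemma iter_displacement_bound:
  "\<bar>iter k x - x - (iter k y - y)\<bar> \<le> 1"
proof -
  have *: "iter k x - x - (iter k y - y) \<le> 1" for x y
  proof -
    define m where "m = \<lceil>x - y\<rceil>"
    have "x \<le> y + of_int m" "y + of_int m \<le> x + 1"
      unfolding m_def by linarith+
    moreover from this have "iter k x \<le> iter k y + of_int m"
      by (metis iter_le_iff iter_shift)
    ultimately show ?thesis by linarith
  qed
  show ?thesis using *[of x y] *[of y x] by linarith
qed

text \<open>
  Up to an error of \<open>1\<close>, the displacements \<open>a\<^sub>n = F\<^sup>n(0)\<close> are additive in \<open>n\<close>. Hence
  \<open>a\<^sub>m\<^sub>n/(mn)\<close> is within \<open>1/n\<close> of \<open>a\<^sub>n/n\<close> and within \<open>1/m\<close> of \<open>a\<^sub>m/m\<close>, which makes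
  \<open>a\<^sub>n/n\<close> a Cauchy sequence whose limit \<open>L\<close> satisfies \<open>\<bar>a\<^sub>n - nL\<bar> \<le> 1\<close>. The change to another
  starting point \<open>x\<close> costs a further \<open>1\<close>.
\<close>
lemma bounded_deviation_exists:
  "\<exists>L. \<forall>k x. \<bar>iter k x - x - of_int k * L\<bar> \<le> 2"
proof -
  define a where "a n = iter (int n) 0" for n
  have add: "\<bar>a (m + n) - a m - a n\<bar> \<le> 1" for m n
    using iter_displacement_bound[of "int m" "a n" 0]
    by (simp add: a_def iter_add)
  have mult: "\<bar>a (m * n) - real m * a n\<bar> \<le> real m" for m n
  proof (induction m)
    case 0
    then show ?case by (simp add: a_def)
  next
    case (Suc m)
    then show ?case
      using add[of n "m * n"] by (simp add: distrib_right)
  qed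
  have quot: "\<bar>a (m * n) / real (m * n) - a n / real n\<bar> \<le> 1 / real n" if "m > 0" "n > 0" for m n
  proof -
    have "a (m * n) / real (m * n) - a n / real n = (a (m * n) - real m * a n) / real (m * n)"
      using that by (simp add: diff_divide_distrib)
    also have "\<bar>\<dots>\<bar> \<le> real m / real (m * n)"
      unfolding abs_divide abs_of_nat using mult[of m n] by (intro divide_right_mono) auto
    finally show ?thesis using that by simp
  qed
  have close: "\<bar>a m / real m - a n / real n\<bar> \<le> 1 / real m + 1 / real n" if "m > 0" "n > 0" for m n
    using quot[of m n] quot[of n m] that unfolding mult.commute[of n m] by linarith
  have "Cauchy (\<lambda>n. a n / real n)"
  proof (rule CauchyI)
    fix e :: real assume "e > 0"
    then obtain N where N: "N > 0" "1 / real N < e / 2"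
      using real_arch_inverse[of "e / 2"] by (auto simp: inverse_eq_divide)
    have "norm (a m / real m - a n / real n) < e" if "m \<ge> N" "n \<ge> N" for m n
    proof -
      have "1 / real m \<le> 1 / real N" "1 / real n \<le> 1 / real N"
        using that N by (auto simp: frac_le)
      moreover have "m > 0" "n > 0" using that N by auto
      ultimately show ?thesis
        using close[of m n] N(2) unfolding real_norm_def by linarith
    qed
    then show "\<exists>N. \<forall>m\<ge>N. \<forall>n\<ge>N. norm (a m / real m - a n / real n) < e"
      by blast
  qed
  then obtain L where L: "(\<lambda>n. a n / real n) \<longlonglongrightarrow> L"
    using real_Cauchy_convergent convergent_def by blast
  have dev: "\<bar>iter (int n) x - x - real n * L\<bar> \<le> 2" for n x
  proof (cases "n = 0")
    case False
    have "(\<lambda>m. a (m * n) / real (m * n)) \<longlonglongrightarrow> L"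
      using LIMSEQ_subseq_LIMSEQ[OF L, of "\<lambda>m. m * n"] False
      by (simp add: strict_mono_def o_def)
    then have "(\<lambda>m. \<bar>a (m * n) / real (m * n) - a n / real n\<bar>) \<longlonglongrightarrow> \<bar>L - a n / real n\<bar>"
      by (intro tendsto_intros)
    then have "\<bar>L - a n / real n\<bar> \<le> 1 / real n"
      by (rule LIMSEQ_le_const2) (use quot False in \<open>auto intro!: exI[of _ 1]\<close>)
    then have "real n * \<bar>L - a n / real n\<bar> \<le> 1"
      using False by (simp add: field_simps)
    then have "\<bar>real n * (L - a n / real n)\<bar> \<le> 1"
      by (simp add: abs_mult)
    also have "real n * (L - a n / real n) = real n * L - a n"
      using False by (simp add: right_diff_distrib)
    finally have "\<bar>real n * L - a n\<bar> \<le> 1" .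
    then show ?thesis
      using iter_displacement_bound[of "int n" x 0] unfolding a_def by linarith
  qed simp
  have "\<bar>iter k x - x - of_int k * L\<bar> \<le> 2" for k x
  proof (cases "k \<ge> 0")
    case True
    then show ?thesis using dev[of "nat k" x] by simp
  next
    case False
    have "iter (- k) (iter k x) = x"
      by (simp flip: iter_add)
    then show ?thesis using dev[of "nat (- k)" "iter k x"] False by simp
  qed
  then show ?thesis by blast
qed

text \<open>
  The translation number. That the iterates deviate boundedly from those of the translation
  determines it and is more convenient than the limit of \<open>F\<^sup>n(x)/n\<close>, which follows.
\<close>
definition transl :: real
  where "transl = (SOME L. \<forall>k x. \<bar>iter k x - x - of_int k * L\<bar> \<le> 2)"

lemma bounded_deviation: "\<bar>iter k x - x - of_int k * transl\<bar> \<le> 2"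
  using someI_ex[OF bounded_deviation_exists] unfolding transl_def by blast

lemma transl_limit: "(\<lambda>n. (F ^^ n) x / real n) \<longlonglongrightarrow> transl"
proof -
  have "(\<lambda>n. (F ^^ n) x / real n - transl) \<longlonglongrightarrow> 0"
  proof (rule Lim_null_comparison)
    show "\<forall>\<^sub>F n in sequentially. norm ((F ^^ n) x / real n - transl) \<le> (2 + \<bar>x\<bar>) / real n"
      using eventually_gt_at_top[of 0]
    proof eventually_elim
      case (elim n)
      then have "(F ^^ n) x / real n - transl = ((F ^^ n) x - real n * transl) / real n"
        by (simp add: diff_divide_distrib)
      also have "norm \<dots> \<le> (2 + \<bar>x\<bar>) / real n"
        unfolding norm_divide using bounded_deviation[of "int n" x]
        by (intro divide_mono) (use elim in \<open>auto simp: ziter_of_nat\<close>)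
      finally show ?case .
    qed
  qed (rule lim_const_over_n)
  then show ?thesis by (rule LIM_zero_cancel)
qed

text \<open>
  If \<open>x\<close> is moved to the left by \<open>G = F\<^sup>n + m\<close>, then so it is by all iterates of \<open>G\<close>; but these
  stay within distance \<open>2\<close> of the translations by multiples of \<open>n\<tau> + m\<close>.
\<close>
lemma transl_le:
  assumes "iter n x + of_int m \<le> x"
  shows "of_int n * transl + of_int m \<le> 0"
proof -
  have *: "iter (n * int k) x + of_nat k * of_int m \<le> x" for k
  proof (induction k)
    case (Suc k)
    have "iter (n * int (Suc k)) x = iter n (iter (n * int k) x)"
      by (simp flip: iter_add add: algebra_simps)
    also have "\<dots> \<le> iter n (x + of_int (- int k * m))"
      unfolding iter_le_iff using Suc by simp
    finally show ?case
      using assms unfolding iter_shift by (simp add: distrib_right)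
  qed simp
  have "of_nat k * (of_int n * transl + of_int m) \<le> 2" for k
    using *[of k] bounded_deviation[of "n * int k" x] by (simp add: algebra_simps)
  then show ?thesis
    by (metis not_less reals_Archimedean3)
qed

lemma transl_ge:
  assumes "x \<le> iter n x + of_int m"
  shows "0 \<le> of_int n * transl + of_int m"
proof -
  have "iter (- n) (iter n x) = x"
    by (simp flip: iter_add)
  then show ?thesis
    using transl_le[of "- n" "iter n x" "- m"] assms by simp
qed

end

section \<open>The monotone semiconjugacy to a translation\<close>

locale irrational_homeo = degree_one_homeo +
  assumes irrational: "transl \<notin> \<rat>"
begin

lemma int_combination_eq_0:
  assumes "of_int n * transl + of_int m = 0"
  shows "n = 0" "m = 0"
proof -
  show "n = 0"
  proof (rule ccontr)
    assume "n \<noteq> 0"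
    then have "transl = of_int (- m) / of_int n"
      using assms by (simp add: field_simps)
    then show False
      using irrational Rats_divide Rats_of_int by metis
  qed
  with assms show "m = 0" by simp
qed

text \<open>
  The comparison of \<open>F\<^sup>n(x) + m\<close> with \<open>x\<close> does not depend on \<open>x\<close>: by irrationality the
  weak inequalities for \<open>n\<tau> + m\<close> obtained from both directions are strict unless \<open>n = m = 0\<close>.
\<close>
lemma iter_le_iff_transl:
  "iter n x + of_int m \<le> x \<longleftrightarrow> of_int n * transl + of_int m \<le> 0"
proof
  assume *: "of_int n * transl + of_int m \<le> 0"
  show "iter n x + of_int m \<le> x"
  proof (rule ccontr)
    assume **: "\<not> iter n x + of_int m \<le> x"
    then have "of_int n * transl + of_int m = 0"
      using transl_ge[of x n m] * by simp
    with ** int_combination_eq_0[OF this] show False by simp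
  qed
qed (rule transl_le)

text \<open>
  The semiconjugacy is prescribed on the orbit of \<open>0\<close> by \<open>F\<^sup>n(0) + m \<mapsto> n\<tau> + m\<close>. The supremum below
  \<open>x\<close> is its smallest monotone extension.
\<close>
definition semiconj_set :: "real \<Rightarrow> real set"
  where "semiconj_set x = {of_int n * transl + of_int m | n m. iter n 0 + of_int m \<le> x}"

definition semiconj :: "real \<Rightarrow> real"
  where "semiconj x = Sup (semiconj_set x)"

lemma semiconj_set_nonempty: "semiconj_set x \<noteq> {}"
proof -
  have "of_int 0 * transl + of_int \<lfloor>x\<rfloor> \<in> semiconj_set x"
    unfolding semiconj_set_def by (intro CollectI exI[of _ 0] exI[of _ "\<lfloor>x\<rfloor>"]) simp
  then show ?thesis by blast
qed

lemma semiconj_set_bdd_above: "bdd_above (semiconj_set x)"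
proof (rule bdd_aboveI)
  fix r assume "r \<in> semiconj_set x"
  then obtain n m where r: "r = of_int n * transl + of_int m" "iter n 0 + of_int m \<le> x"
    unfolding semiconj_set_def by blast
  then have "iter n 0 + of_int (m - \<lceil>x\<rceil>) \<le> 0"
    using le_of_int_ceiling[of x] by simp linarith
  from transl_le[OF this] show "r \<le> of_int \<lceil>x\<rceil>"
    using r by simp
qed

lemma semiconj_mono: "x \<le> y \<Longrightarrow> semiconj x \<le> semiconj y"
  unfolding semiconj_def
  by (rule cSup_subset_mono[OF semiconj_set_nonempty semiconj_set_bdd_above])
    (auto simp: semiconj_set_def intro: order_trans)

lemma semiconj_less_imp_less: "semiconj x < semiconj y \<Longrightarrow> x < y"
  using semiconj_mono by (meson not_less)

text \<open>
  The homeomorphism \<open>x \<mapsto> F\<^sup>n(x) + m\<close> preserves the order and permutes the points \<open>F\<^sup>k(0) + l\<close>, so it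
  shifts the sets whose suprema are taken by \<open>n\<tau> + m\<close>. One inequality suffices: the other
  is the same one for the inverse homeomorphism.
\<close>
lemma semiconj_iter: "semiconj (iter n x + of_int m) = semiconj x + of_int n * transl + of_int m"
proof -
  have ge: "semiconj x + (of_int n * transl + of_int m) \<le> semiconj (iter n x + of_int m)" for n m x
  proof -
    have "r + (of_int n * transl + of_int m) \<le> semiconj (iter n x + of_int m)" if "r \<in> semiconj_set x" for r
    proof -
      obtain k l where r: "r = of_int k * transl + of_int l" and le: "iter k 0 + of_int l \<le> x"
        using \<open>r \<in> semiconj_set x\<close> unfolding semiconj_set_def by blast
      have "iter (n + k) 0 + of_int (l + m) = iter n (iter k 0 + of_int l) + of_int m"
        by (simp add: iter_add iter_shift)
      also have "\<dots> \<le> iter n x + of_int m"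
        using le by simp
      finally have "of_int (n + k) * transl + of_int (l + m) \<in> semiconj_set (iter n x + of_int m)"
        unfolding semiconj_set_def by blast
      from cSup_upper[OF this semiconj_set_bdd_above] show ?thesis
        by (simp add: semiconj_def r algebra_simps)
    qed
    then have "semiconj x \<le> semiconj (iter n x + of_int m) - (of_int n * transl + of_int m)"
      unfolding semiconj_def[of x] by (intro cSup_least[OF semiconj_set_nonempty]) (simp add: le_diff_eq)
    then show ?thesis by simp
  qed
  have "iter (- n) (iter n x + of_int m) + of_int (- m) = x"
    by (simp add: iter_shift flip: iter_add)
  with ge[of "iter n x + of_int m" "- n" "- m"] ge[of x n m] show ?thesis by simp
qed

lemma semiconj_add_of_int: "semiconj (x + of_int m) = semiconj x + of_int m"
  using semiconj_iter[of 0 x m] by simp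

lemma semiconj_F: "semiconj (F x) = semiconj x + transl"
  using semiconj_iter[of 1 x 0] iter_plus_1[of 0 x] by simp

text \<open>
  The sign \<open>s\<close> serves to treat forward and backward orbits at once: Kronecker's theorem is applied
  to \<open>s\<tau>\<close>, after an initial segment of \<open>N\<close> steps that makes the time late.
\<close>
lemma orbit_between:
  assumes "a < b" "\<bar>s\<bar> = 1"
  obtains n :: nat and m :: int where "n \<ge> N" "semiconj (iter (s * int n) x + of_int m) \<in> {a<..<b}"
proof -
  have "of_int s * transl \<notin> \<rat>"
    using irrational assms(2) by (auto simp: abs_if split: if_splits)
  moreover define c where "c = (a + b) / 2 - semiconj x - real N * of_int s * transl"
  ultimately obtain h k where k: "k > 0"
    and "\<bar>of_int k * (of_int s * transl) - of_int h - c\<bar> < (b - a) / 2"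
    using assms(1) by (metis sequence_of_fractional_parts_is_dense diff_gt_0_iff_gt half_gt_zero)
  moreover have "semiconj (iter (s * int (N + nat k)) x + of_int (- h))
      = semiconj x + of_int s * (real N + of_int k) * transl - of_int h"
    unfolding semiconj_iter using k by simp
  ultimately have "semiconj (iter (s * int (N + nat k)) x + of_int (- h)) \<in> {a<..<b}"
    unfolding c_def abs_less_iff by (simp add: field_simps)
  then show thesis
    by (rule that[rotated]) simp
qed

text \<open>A monotone function with dense range has no jumps.\<close>
lemma isCont_semiconj: "isCont semiconj x"
  unfolding isCont_def
proof (rule LIM_I)
  fix e :: real assume "e > 0"
  have dense: "\<exists>p. semiconj p \<in> {a<..<b}" if "a < b" for a b
    using orbit_between[OF that, of 1] by (metis abs_one)
  obtain p q where p: "semiconj x - e < semiconj p" "semiconj p < semiconj x"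
    and q: "semiconj x < semiconj q" "semiconj q < semiconj x + e"
    using dense[of "semiconj x - e" "semiconj x"] dense[of "semiconj x" "semiconj x + e"] \<open>e > 0\<close>
    by auto
  have pq: "p < x" "x < q"
    using p q semiconj_less_imp_less by auto
  show "\<exists>d>0. \<forall>y. y \<noteq> x \<and> norm (y - x) < d \<longrightarrow> norm (semiconj y - semiconj x) < e"
  proof (intro exI[of _ "min (x - p) (q - x)"] conjI allI impI)
    fix y assume "y \<noteq> x \<and> norm (y - x) < min (x - p) (q - x)"
    then have "p \<le> y" "y \<le> q" by auto
    from this[THEN semiconj_mono] p q show "norm (semiconj y - semiconj x) < e" by auto
  qed (use pq in simp)
qed

text \<open>
  The orbit of \<open>x\<close> has a dense image under the semiconjugacy, which is monotone. So as soon as the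
  semiconjugacy is not constant near \<open>v\<close>, every forward and every backward orbit enters each
  neighbourhood of \<open>v\<close>, up to integers, at arbitrarily late times.
\<close>
lemma orbit_accumulates:
  assumes "\<And>\<epsilon>. \<epsilon> > 0 \<Longrightarrow> \<exists>a b. \<bar>a - v\<bar> < \<epsilon> \<and> \<bar>b - v\<bar> < \<epsilon> \<and> semiconj a \<noteq> semiconj b"
    and "\<bar>s\<bar> = 1"
  obtains n :: "nat \<Rightarrow> nat" and m :: "nat \<Rightarrow> int"
  where "strict_mono n" "(\<lambda>k. iter (s * int (n k)) x + of_int (m k)) \<longlonglongrightarrow> v"
proof -
  have late: "\<exists>n\<ge>N. \<exists>m. \<bar>iter (s * int n) x + of_int m - v\<bar> < \<epsilon>" if "\<epsilon> > 0" for \<epsilon> N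
  proof -
    obtain a b where ab: "\<bar>a - v\<bar> < \<epsilon>" "\<bar>b - v\<bar> < \<epsilon>" "semiconj a < semiconj b"
      using assms(1)[OF \<open>\<epsilon> > 0\<close>] by (metis linorder_neqE)
    obtain n m where "n \<ge> N" "semiconj (iter (s * int n) x + of_int m) \<in> {semiconj a<..<semiconj b}"
      using orbit_between[OF ab(3) assms(2)] by metis
    then have "a < iter (s * int n) x + of_int m" "iter (s * int n) x + of_int m < b"
      using semiconj_less_imp_less by auto
    then have "\<bar>iter (s * int n) x + of_int m - v\<bar> < \<epsilon>"
      using ab by linarith
    then show ?thesis using \<open>n \<ge> N\<close> by blast
  qed
  let ?close = "\<lambda>k n. \<exists>m. \<bar>iter (s * int n) x + of_int m - v\<bar> < inverse (real (Suc k))"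
  have "\<exists>n. \<forall>k. ?close k (n k) \<and> n k < n (Suc k)"
  proof (rule dependent_nat_choice)
    show "\<exists>n. ?close 0 n"
      using late[of "inverse (real (Suc 0))" 0] by auto
    show "\<exists>n'. ?close (Suc k) n' \<and> n < n'" for n k
      using late[of "inverse (real (Suc (Suc k)))" "Suc n"] by (auto simp: Suc_le_eq)
  qed
  then obtain n where n: "\<And>k. ?close k (n k)" "\<And>k. n k < n (Suc k)" by blast
  from n(1) obtain m :: "nat \<Rightarrow> int"
    where m: "\<And>k. \<bar>iter (s * int (n k)) x + of_int (m k) - v\<bar> < inverse (real (Suc k))"
    by metis
  show thesis
  proof (rule that)
    show "strict_mono n" using n(2) by (rule strict_monoI_Suc)
    have "(\<lambda>k. iter (s * int (n k)) x + of_int (m k) - v) \<longlonglongrightarrow> 0"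
      by (rule Lim_null_comparison[OF _ LIMSEQ_inverse_real_of_nat])
        (use m in \<open>auto intro!: always_eventually less_imp_le\<close>)
    then show "(\<lambda>k. iter (s * int (n k)) x + of_int (m k)) \<longlonglongrightarrow> v"
      by (rule LIM_zero_cancel)
  qed
qed

section \<open>The displacement function\<close>

definition step :: "real \<Rightarrow> real"
  where "step x = frac (F x - x)"

text \<open>
  As \<open>F\<close> has no periodic point modulo \<open>1\<close>, the graph of \<open>F x - x\<close> stays strictly between two
  consecutive integers, so that reduction modulo \<open>1\<close> does not destroy continuity.
\<close>
lemma step_eq: "step x = F x - x - of_int \<lfloor>transl\<rfloor>"
proof -
  have *: "F x - x \<le> of_int k \<longleftrightarrow> transl \<le> of_int k" for k
    using iter_le_iff_transl[of 1 x "- k"] iter_plus_1[of 0 x] by auto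
  have **: "of_int k \<le> F x - x \<longleftrightarrow> of_int k \<le> transl" for k
  proof -
    have "of_int k \<noteq> transl"
      using irrational Rats_of_int by metis
    moreover have "of_int k \<noteq> F x - x"
    proof
      assume "of_int k = F x - x"
      then have "x = iter 1 x + of_int (- k)"
        using iter_plus_1[of 0 x] by simp
      then have "of_int 1 * transl + of_int (- k) = 0"
        using transl_le[of 1 x "- k"] transl_ge[of x 1 "- k"] by linarith
      then show False using int_combination_eq_0(1) by fastforce
    qed
    ultimately show ?thesis using *[of k] by linarith
  qed
  have "\<lfloor>F x - x\<rfloor> = \<lfloor>transl\<rfloor>"
    using **[of "\<lfloor>transl\<rfloor>"] **[of "\<lfloor>transl\<rfloor> + 1"] by linarith
  then show ?thesis by (simp add: step_def frac_def)
qed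

lemma isCont_step: "isCont step x"
proof -
  have "isCont F x"
    using cont by (simp add: continuous_on_eq_continuous_at)
  then show ?thesis
    unfolding step_eq[abs_def] by (intro continuous_intros)
qed

lemma step_add_of_int: "step (x + of_int m) = step x"
  using shift_by_int[of F 1 x m, OF shift] by (simp add: step_def)

lemma displacement_cover:
  "displacement F l (cover x) = step (iter (l - 1) x)"
proof -
  define y where "y = Arg2pi (cover x) / (2 * pi)"
  have "cover y = cover x"
    unfolding y_def by (rule cover_Arg2pi) simp
  then obtain i :: int where y: "y = x + of_int i"
    using cover_eq_iff by blast
  have "displacement F l (cover x) = frac (iter l y - iter (l - 1) y)"
    unfolding displacement_def y_def Let_def ..
  also have "\<dots> = step (iter (l - 1) y)"
    using iter_plus_1[of "l - 1" y] by (simp add: step_def)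
  also have "\<dots> = step (iter (l - 1) x)"
    unfolding y iter_shift step_add_of_int ..
  finally show ?thesis .
qed

text \<open>
  Convergence is required only modulo \<open>1\<close>, because the displacement is periodic.
\<close>
lemma displacement_tendsto:
  assumes "(\<lambda>k. iter (j k) x + of_int (m k)) \<longlonglongrightarrow> v"
  shows "(\<lambda>k. displacement F l (cover (iter (j k) x))) \<longlonglongrightarrow> displacement F l (cover v)"
proof -
  have "isCont (iter (l - 1)) v"
    using continuous_on_iter by (simp add: continuous_on_eq_continuous_at)
  then have "(\<lambda>k. step (iter (l - 1) (iter (j k) x + of_int (m k)))) \<longlonglongrightarrow> step (iter (l - 1) v)"
    by (intro isCont_tendsto_compose[OF isCont_step] isCont_tendsto_compose[OF _ assms])
  then show ?thesis
    unfolding displacement_cover iter_shift step_add_of_int .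
qed

text \<open>
  The continuous image of \<open>[0,1]\<close> is a compact interval, so it fills the gap between its
  extrema, and by periodicity it is the whole range.
\<close>
lemma min_max_interval_step:
  "min_max_interval step = range step" "step ` {0..1} = range step"
proof -
  have "continuous_on {0..1} step"
    by (intro continuous_at_imp_continuous_on ballI isCont_step)
  then obtain c d where cd: "step ` {0..1} = {c..d}" "c \<le> d"
    using continuous_image_closed_interval[of 0 1 step] by auto
  have "(LEAST y. y \<in> {c..d}) = c" "(GREATEST y. y \<in> {c..d}) = d"
    using cd(2) by (auto intro!: Least_equality Greatest_equality)
  then have "min_max_interval step = step ` {0..1}"
    unfolding min_max_interval_def cd(1) by simp
  moreover have "step x \<in> step ` {0..1}" for x
    by (rule image_eqI[of _ _ "x + of_int (- \<lfloor>x\<rfloor>)"])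
      (simp add: step_add_of_int del: of_int_minus, simp, linarith)
  ultimately show "min_max_interval step = range step" "step ` {0..1} = range step"
    by auto
qed

end

section \<open>Minimal sets are recurrent\<close>

text \<open>The \<open>\<omega>\<close>-limit set of \<open>w\<close> is closed, nonempty and invariant, so it exhausts the minimal set.\<close>
lemma minimal_set_recurrent:
  assumes f: "continuous_on circle f" "inj_on f circle" "f ` circle = circle"
    and \<Delta>: "minimal_set f \<Delta>" and w: "w \<in> \<Delta>"
  shows "w \<in> closure {(f ^^ n) w | n. n \<ge> N}"
proof -
  define C where "C N = closure {(f ^^ n) w | n. n \<ge> N}" for N
  have inv: "f ` \<Delta> = \<Delta>" "\<Delta> \<subseteq> circle" "closed \<Delta>"
    and min: "\<And>B. closed_invariant f B \<Longrightarrow> B \<subseteq> \<Delta> \<Longrightarrow> B = \<Delta>"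
    using \<Delta> unfolding minimal_set_def closed_invariant_def by auto
  have orbit: "(f ^^ n) w \<in> \<Delta>" for n
    by (induction n) (use w inv in auto)
  have C_sub: "C N \<subseteq> \<Delta>" for N
    unfolding C_def using orbit inv(3) by (intro closure_minimal) auto
  have "compact \<Delta>"
    using compact_Int_closed[OF compact_sphere inv(3), of 0 1] inv(2) by (simp add: Int_absorb1)
  then have C_compact: "compact (C N)" for N
    using compact_Int_closed[of \<Delta> "C N"] C_sub[of N] by (simp add: Int_absorb1 C_def)
  have C_mono: "C N \<subseteq> C M" if "M \<le> N" for M N
    unfolding C_def using that by (intro closure_mono) (blast intro: order_trans)
  have f_cont: "continuous_on (C N) f" for N
    using f(1) C_sub[of N] inv(2) by (meson continuous_on_subset subset_trans)
  have image_tail: "f ` {(f ^^ n) w | n. n \<ge> N} = {(f ^^ n) w | n. n \<ge> Suc N}" for N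
  proof (intro equalityI subsetI; clarify)
    fix n assume "N \<le> n"
    then show "\<exists>k. f ((f ^^ n) w) = (f ^^ k) w \<and> Suc N \<le> k"
      by (intro exI[of _ "Suc n"]) simp
  next
    fix n assume "Suc N \<le> n"
    then obtain k where "n = Suc k" "N \<le> k"
      by (cases n) auto
    then show "(f ^^ n) w \<in> f ` {(f ^^ n) w | n. n \<ge> N}"
      by auto
  qed
  have f_C: "f ` C N = C (Suc N)" for N
  proof
    show "f ` C N \<subseteq> C (Suc N)"
      unfolding C_def
      by (rule image_closure_subset[OF f_cont[unfolded C_def] closed_closure])
        (simp add: image_tail closure_subset)
    have "{(f ^^ n) w | n. n \<ge> Suc N} \<subseteq> f ` C N"
      unfolding image_tail[symmetric] C_def by (intro image_mono closure_subset)
    then show "C (Suc N) \<subseteq> f ` C N"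
      unfolding C_def[of "Suc N"]
      by (intro closure_minimal compact_imp_closed compact_continuous_image f_cont C_compact)
  qed
  have "f ` (\<Inter>N. C N) = (\<Inter>N. f ` C N)"
    using f(2) C_sub inv(2) by (intro image_INT[of _ circle]) auto
  also have "\<dots> = (\<Inter>N. C (Suc N))"
    unfolding f_C ..
  also have "\<dots> = (\<Inter>N. C N)"
    using C_mono[OF le_SucI[OF order_refl]] by blast
  finally have "f ` (\<Inter>N. C N) = (\<Inter>N. C N)" .
  moreover have "(\<Inter>N. C N) \<noteq> {}"
  proof (rule compact_nest)
    show "C N \<noteq> {}" for N unfolding C_def by auto
  qed (use C_compact C_mono in auto)
  moreover have "closed (\<Inter>N. C N)"
    unfolding C_def by (intro closed_INT ballI closed_closure)
  moreover have sub: "(\<Inter>N. C N) \<subseteq> \<Delta>"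
    using C_sub by (rule INF_lower2[OF UNIV_I])
  ultimately have "closed_invariant f (\<Inter>N. C N)"
    using inv(2) unfolding closed_invariant_def by (meson subset_trans)
  from min[OF this sub] w have "w \<in> C N" by auto
  then show ?thesis unfolding C_def .
qed

section \<open>Circle homeomorphisms with irrational rotation number\<close>

lemma circle_homeo_bij:
  assumes "circle_homeo f"
  shows "continuous_on circle f" "bij_betw f circle circle"
proof -
  obtain g where g: "homeomorphism circle circle f g"
    using assms unfolding circle_homeo_def by blast
  then show "continuous_on circle f"
    by (simp add: homeomorphism_def)
  show "bij_betw f circle circle"
    using g unfolding homeomorphism_def by (intro bij_betw_byWitness[where f' = g]) auto
qed

locale irrational_circle_homeo = irrational_homeo +
  fixes f
  assumes homeo: "circle_homeo f" and lift: "circle_lift f F"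
begin

lemma f_props: "continuous_on circle f" "bij_betw f circle circle" "inj_on f circle"
  "f ` circle = circle"
  using circle_homeo_bij[OF homeo] by (auto simp: bij_betw_def)

lemma ziter_cover: "ziter circle f k (cover x) = cover (iter k x)"
proof -
  have "cover (iter k x) = ziter circle f k (cover x)"
    by (rule ziter_semiconj[OF bij f_props(2)]) (use lift in \<open>auto simp: circle_lift_def\<close>)
  then show ?thesis ..
qed

lemma displacement_ziter_tendsto:
  assumes "\<And>\<epsilon>. \<epsilon> > 0 \<Longrightarrow> \<exists>a b. \<bar>a - v\<bar> < \<epsilon> \<and> \<bar>b - v\<bar> < \<epsilon> \<and> semiconj a \<noteq> semiconj b"
    and "\<bar>s\<bar> = 1"
  obtains n :: "nat \<Rightarrow> nat" where "strict_mono n"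
    "\<And>l. (\<lambda>k. displacement F l (ziter circle f (s * int (n k)) (cover x)))
       \<longlonglongrightarrow> displacement F l (cover v)"
proof -
  obtain n m where "strict_mono n" "(\<lambda>k. iter (s * int (n k)) x + of_int (m k)) \<longlonglongrightarrow> v"
    using orbit_accumulates[OF assms, where x = x] by blast
  then show thesis
    using displacement_tendsto by (intro that) (auto simp: ziter_cover)
qed

text \<open>
  The set \<open>S\<close> stands for any choice of representatives that is rich enough to represent the forward
  orbit: the whole line in the transitive case, the part of \<open>[0,1)\<close> above the minimal set otherwise.
\<close>
lemma displacement_dense:
  assumes "\<And>v \<epsilon>. v \<in> S \<Longrightarrow> \<epsilon> > 0 \<Longrightarrow>
      \<exists>a b. \<bar>a - v\<bar> < \<epsilon> \<and> \<bar>b - v\<bar> < \<epsilon> \<and> semiconj a \<noteq> semiconj b"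
    and "\<And>n. \<exists>v\<in>S. cover v = cover (iter (int n) x)"
  shows "dense_in_set ((\<lambda>n. displacement F n (cover x)) ` {1..}) (step ` S)"
  unfolding dense_in_set_def
proof (intro conjI subsetI)
  have disp: "displacement F (int n + 1) (cover x) = step (iter (int n) x)" for n
    by (simp add: displacement_cover)
  {
    fix r assume "r \<in> (\<lambda>n. displacement F n (cover x)) ` {1..}"
    then obtain j :: int where j: "j \<ge> 1" "r = displacement F j (cover x)"
      by auto
    define n where "n = nat (j - 1)"
    have r: "r = step (iter (int n) x)"
      using j disp[of n] by (simp add: n_def)
    obtain v where v: "v \<in> S" "cover v = cover (iter (int n) x)"
      using assms(2) by blast
    then obtain i :: int where "v = iter (int n) x + of_int i"
      using cover_eq_iff by blast
    with v(1) r show "r \<in> step ` S"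
      using step_add_of_int by (metis imageI)
  next
    fix r assume "r \<in> step ` S"
    then obtain v where v: "v \<in> S" "r = step v" by blast
    obtain n where "\<And>l. (\<lambda>k. displacement F l (ziter circle f (1 * int (n k)) (cover x)))
        \<longlonglongrightarrow> displacement F l (cover v)"
      using displacement_ziter_tendsto[OF assms(1)[OF v(1)], of 1 x] by (metis abs_one)
    from this[of 1] have lim: "(\<lambda>k. step (iter (int (n k)) x)) \<longlonglongrightarrow> r"
      by (simp add: ziter_cover displacement_cover v(2))
    show "r \<in> closure ((\<lambda>n. displacement F n (cover x)) ` {1..})"
      unfolding closure_sequential
    proof (intro exI conjI allI)
      show "step (iter (int (n k)) x) \<in> (\<lambda>n. displacement F n (cover x)) ` {1..}" for k
        unfolding disp[symmetric] by (intro imageI) simp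
    qed (rule lim)
  }
qed

text \<open>
  By recurrence there are arbitrarily close to \<open>v\<close> points \<open>F\<^sup>n(v) + m\<close> with \<open>n \<ge> 1\<close>, and the
  semiconjugacy moves such a point by \<open>n\<tau> + m \<noteq> 0\<close>.
\<close>
lemma minimal_set_not_flat:
  assumes "minimal_set f \<Delta>" "cover v \<in> \<Delta>" "\<epsilon> > 0"
  shows "\<exists>a b. \<bar>a - v\<bar> < \<epsilon> \<and> \<bar>b - v\<bar> < \<epsilon> \<and> semiconj a \<noteq> semiconj b"
proof -
  obtain \<delta> where \<delta>: "\<delta> > 0"
    "\<And>a b. dist (cover a) (cover b) < \<delta> \<Longrightarrow> \<exists>m::int. \<bar>a + of_int m - b\<bar> < \<epsilon>"
    using close_representatives[OF assms(3)] by blast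
  have "cover v \<in> closure {(f ^^ n) (cover v) | n. n \<ge> 1}"
    by (rule minimal_set_recurrent[OF f_props(1,3,4) assms(1,2)])
  then obtain n where n: "n \<ge> 1" "dist ((f ^^ n) (cover v)) (cover v) < \<delta>"
    using \<delta>(1) unfolding closure_approachable by blast
  have "(f ^^ n) (cover v) = cover (iter (int n) v)"
    using ziter_cover[of "int n" v] by (simp add: ziter_of_nat)
  with n \<delta>(2) obtain m :: int where m: "\<bar>iter (int n) v + of_int m - v\<bar> < \<epsilon>"
    by metis
  have "semiconj (iter (int n) v + of_int m) \<noteq> semiconj v"
    using int_combination_eq_0(1)[of "int n" m] n(1) unfolding semiconj_iter by auto
  with m assms(3) show ?thesis
    by (intro exI[of _ "iter (int n) v + of_int m"] exI[of _ v]) simp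
qed

text \<open>
  A dense orbit meets the interior of each interval in two points; these are distinct points of one
  orbit, which the semiconjugacy separates because \<open>n\<tau> + m\<close> determines \<open>n\<close> and \<open>m\<close>.
\<close>
lemma transitive_imp_semiconj_strict_mono:
  assumes "circle_transitive f"
  shows "strict_mono semiconj"
proof -
  obtain z where z: "z \<in> circle" "circle \<subseteq> closure (range (\<lambda>k. ziter circle f k z))"
    using assms unfolding circle_transitive_def by blast
  obtain x where x: "z = cover x"
    using z(1) by (rule circle_coverE)
  have near: "\<exists>n m. \<bar>iter n x + of_int m - v\<bar> < \<epsilon>" if "\<epsilon> > 0" for v \<epsilon>
  proof -
    obtain \<delta> where \<delta>: "\<delta> > 0"
      "\<And>a b. dist (cover a) (cover b) < \<delta> \<Longrightarrow> \<exists>m::int. \<bar>a + of_int m - b\<bar> < \<epsilon>"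
      using close_representatives[OF \<open>\<epsilon> > 0\<close>] by blast
    have "cover v \<in> closure (range (\<lambda>k. cover (iter k x)))"
      using z(2) cover_in_circle[of v] unfolding x ziter_cover by blast
    then obtain k where "dist (cover (iter k x)) (cover v) < \<delta>"
      using \<delta>(1) unfolding closure_approachable by blast
    with \<delta>(2) show ?thesis by blast
  qed
  show ?thesis
  proof (rule strict_monoI)
    fix a b :: real assume "a < b"
    define e where "e = (b - a) / 4"
    have "e > 0" using \<open>a < b\<close> by (simp add: e_def)
    obtain n m where p: "\<bar>iter n x + of_int m - (a + e)\<bar> < e"
      using near[OF \<open>e > 0\<close>] by blast
    obtain k l where q: "\<bar>iter k x + of_int l - (b - e)\<bar> < e"
      using near[OF \<open>e > 0\<close>] by blast
    have pq: "a \<le> iter n x + of_int m" "iter n x + of_int m < iter k x + of_int l"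
      "iter k x + of_int l \<le> b"
      using p q unfolding e_def abs_less_iff by (simp_all add: field_simps)
    have "semiconj (iter n x + of_int m) \<noteq> semiconj (iter k x + of_int l)"
    proof
      assume "semiconj (iter n x + of_int m) = semiconj (iter k x + of_int l)"
      then have "of_int (n - k) * transl + of_int (m - l) = 0"
        unfolding semiconj_iter by (simp add: algebra_simps)
      from int_combination_eq_0[OF this] pq show False by simp
    qed
    with less_imp_le[OF pq(2)] semiconj_mono[of "iter n x + of_int m" "iter k x + of_int l"]
      semiconj_mono[OF pq(1)] semiconj_mono[OF pq(3)]
    show "semiconj a < semiconj b" by simp
  qed
qed

lemma transitive_imp_not_flat:
  assumes "circle_transitive f" "\<epsilon> > 0"
  shows "\<exists>a b. \<bar>a - v\<bar> < \<epsilon> \<and> \<bar>b - v\<bar> < \<epsilon> \<and> semiconj a \<noteq> semiconj b"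
  using strict_monoD[OF transitive_imp_semiconj_strict_mono[OF assms(1)], of v "v + \<epsilon> / 2"] assms(2)
  by (intro exI[of _ v] exI[of _ "v + \<epsilon> / 2"]) simp

text \<open>
  A strictly increasing semiconjugacy has degree one and descends to the circle. The quotient map
  is continuous because the preimage of a closed set is the image of a compact
  subset of \<open>[0,1]\<close> under the covering.
\<close>
lemma transitive_imp_conjugate:
  assumes "circle_transitive f"
  shows "\<exists>\<gamma>. conjugates_to_rotation \<gamma> f (frac transl) \<and> circle_lift \<gamma> semiconj"
proof -
  note sm = transitive_imp_semiconj_strict_mono[OF assms]
  have cont_semiconj: "continuous_on UNIV semiconj"
    using isCont_semiconj by (simp add: continuous_on_eq_continuous_at)
  define \<gamma> where "\<gamma> z = cover (semiconj (Arg2pi z / (2 * pi)))" for z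
  have \<gamma>: "\<gamma> (cover x) = cover (semiconj x)" for x
  proof -
    obtain i :: int where "Arg2pi (cover x) / (2 * pi) = x + of_int i"
      using cover_Arg2pi[of "cover x"] cover_eq_iff by auto
    then show ?thesis by (simp add: \<gamma>_def semiconj_add_of_int)
  qed
  have inj: "inj_on \<gamma> circle"
  proof (rule inj_onI)
    fix z w assume "z \<in> circle" "w \<in> circle" and eq: "\<gamma> z = \<gamma> w"
    then obtain x y where xy: "z = cover x" "w = cover y"
      by (metis circle_coverE)
    then obtain i :: int where "semiconj x = semiconj (y + of_int i)"
      using eq cover_eq_iff by (auto simp: \<gamma> semiconj_add_of_int)
    then have "x = y + of_int i"
      using strict_mono_imp_inj_on[OF sm] by (simp add: inj_eq)
    then show "z = w" using xy by simp
  qed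
  have img: "\<gamma> ` circle = circle"
  proof -
    have "surj semiconj"
      by (rule surj_of_unit_shift[OF cont_semiconj, of 1]) (use semiconj_add_of_int[of _ 1] in auto)
    then have "cover ` UNIV = (\<lambda>x. cover (semiconj x)) ` UNIV"
      by (metis image_image)
    then show ?thesis
      unfolding circle_eq_range_cover image_image \<gamma> by simp
  qed
  have "continuous_on circle \<gamma>"
    unfolding continuous_on_closed_vimage[OF closed_sphere]
  proof (intro allI impI)
    fix B :: "complex set" assume "closed B"
    define K where "K = {0..1} \<inter> (\<lambda>x. cover (semiconj x)) -` B"
    have "closed ((\<lambda>x. cover (semiconj x)) -` B)"
      by (intro continuous_closed_vimage \<open>closed B\<close>)
        (use continuous_on_cover[OF cont_semiconj] in \<open>simp add: continuous_on_eq_continuous_at\<close>)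
    then have "compact K"
      unfolding K_def by (intro compact_Int_closed compact_Icc)
    then have "compact (cover ` K)"
      by (intro compact_continuous_image continuous_intros)
    also have "cover ` K = \<gamma> -` B \<inter> circle"
    proof -
      have "z \<in> cover ` K" if "z \<in> circle" "\<gamma> z \<in> B" for z
      proof -
        have "z \<in> cover ` {0..<1}"
          using that(1) unfolding cover_image_unit_interval .
        then obtain x where "x \<in> {0..<1}" "z = cover x" by blast
        with that(2) show ?thesis
          unfolding K_def by (intro image_eqI[of _ _ x]) (auto simp: \<gamma>)
      qed
      moreover have "cover x \<in> \<gamma> -` B \<inter> circle" if "x \<in> K" for x
        using that unfolding K_def by (simp add: \<gamma>)
      ultimately show ?thesis by blast
    qed
    finally show "closed (\<gamma> -` B \<inter> circle)"
      by (rule compact_imp_closed)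
  qed
  then have "circle_homeo \<gamma>"
    unfolding circle_homeo_def using homeomorphism_compact[OF compact_sphere _ img inj] by blast
  moreover have "f z = inv_into circle \<gamma> (rotation (frac transl) (\<gamma> z))" if "z \<in> circle" for z
  proof -
    obtain x where x: "z = cover x" using \<open>z \<in> circle\<close> by (rule circle_coverE)
    have "cover (frac transl) = cover transl"
      using cover_add_of_int[of "frac transl" "\<lfloor>transl\<rfloor>"] by (simp add: frac_def)
    then have "rotation (frac transl) (\<gamma> z) = cover (semiconj (F x))"
      unfolding x rotation_def \<gamma> semiconj_F cover_add by simp
    also have "\<dots> = \<gamma> (cover (F x))"
      by (rule \<gamma>[symmetric])
    also have "cover (F x) = f z"
      using lift unfolding circle_lift_def x by blast
    finally have "rotation (frac transl) (\<gamma> z) = \<gamma> (f z)" .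
    moreover have "f z \<in> circle" using that f_props(4) by blast
    ultimately show ?thesis by (simp add: inv_into_f_f[OF inj])
  qed
  ultimately show ?thesis
    using cont_semiconj \<gamma> unfolding conjugates_to_rotation_def circle_lift_def by metis
qed

text \<open>
  In the coordinate \<open>\<Gamma>\<close> the map \<open>F\<close> is the translation by \<open>\<tau>\<close> up to an integer, so both
  displacement functions take the same values. A conjugacy of either orientation is
  covered: its degree \<open>d\<close> satisfies \<open>d\<^sup>2 = 1\<close>, so a shift of the values by \<open>j\<close> is a shift of
  the arguments by \<open>j d\<close>.
\<close>
lemma conjugate_displacement:
  assumes "conjugates_to_rotation \<gamma> f \<rho>" "circle_lift \<gamma> \<Gamma>" and \<rho>: "\<rho> \<notin> \<rat>"
  shows "(\<lambda>x. frac (inv \<Gamma> (x + \<rho>) - inv \<Gamma> x)) ` {0..1} = range step"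
proof -
  have \<gamma>: "inj_on \<gamma> circle" "\<gamma> ` circle = circle"
    using assms(1) circle_homeo_bij(2) unfolding conjugates_to_rotation_def bij_betw_def by auto
  have conj: "\<gamma> (f z) = rotation \<rho> (\<gamma> z)" if "z \<in> circle" for z
  proof -
    have "\<gamma> z * cover \<rho> \<in> circle"
      using that \<gamma>(2) by (auto simp: norm_mult)
    then show ?thesis
      using that assms(1) \<gamma>(2) unfolding conjugates_to_rotation_def
      by (simp add: f_inv_into_f rotation_def)
  qed
  have cont_\<Gamma>: "continuous_on UNIV \<Gamma>" and lift_\<Gamma>: "\<And>x. cover (\<Gamma> x) = \<gamma> (cover x)"
    using assms(2) unfolding circle_lift_def by auto
  obtain d :: int where d: "\<And>x. \<Gamma> (x + 1) = \<Gamma> x + of_int d"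
    using lift_degree[OF assms(2)] by metis
  have lift1: "circle_lift (\<lambda>z. \<gamma> (f z)) (\<lambda>x. \<Gamma> (F x))"
    unfolding circle_lift_def
    using continuous_on_compose2[OF cont_\<Gamma> cont] lift by (simp add: lift_\<Gamma> circle_lift_def)
  have lift2: "circle_lift (\<lambda>z. \<gamma> (f z)) (\<lambda>x. \<Gamma> x + \<rho>)"
    unfolding circle_lift_def
    using continuous_on_add[OF cont_\<Gamma> continuous_on_const] conj
    by (simp add: lift_\<Gamma> cover_add rotation_def)
  obtain j :: int where \<Gamma>_F: "\<And>x. \<Gamma> x + \<rho> = \<Gamma> (F x) + of_int j"
    using lift_unique[OF lift1 lift2] by blast
  have per: "\<Gamma> (x + of_int m) = \<Gamma> x + of_int m * of_int d" for x m
    using shift_by_int[of \<Gamma> "of_int d" x m] d by simp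
  \<comment> \<open>A lift of degree zero is periodic and attains its extrema. Passing from \<open>x\<close> to \<open>F x\<close> adds
    \<open>\<rho> - j\<close> to its value, which cannot be positive at a maximum or negative at a minimum.\<close>
  have "d \<noteq> 0"
  proof
    assume "d = 0"
    have \<Gamma>_frac: "\<Gamma> (frac x) = \<Gamma> x" for x
      using per[of "frac x" "\<lfloor>x\<rfloor>"] \<open>d = 0\<close> by (simp add: frac_def)
    have frac01: "frac x \<in> {0..1}" for x :: real
      using frac_ge_0[of x] frac_lt_1[of x] by simp
    have cont01: "continuous_on {0..1} \<Gamma>"
      using cont_\<Gamma> by (rule continuous_on_subset) simp
    have "{0..1::real} \<noteq> {}"
      by simp
    note attains = continuous_attains_sup[OF compact_Icc this cont01]
      continuous_attains_inf[OF compact_Icc this cont01]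
    obtain p where p: "\<And>x. x \<in> {0..1} \<Longrightarrow> \<Gamma> x \<le> \<Gamma> p"
      using attains(1) by blast
    obtain q where q: "\<And>x. x \<in> {0..1} \<Longrightarrow> \<Gamma> q \<le> \<Gamma> x"
      using attains(2) by blast
    have "\<rho> = of_int j"
      using p[OF frac01, of "F p"] q[OF frac01, of "F q"] \<Gamma>_F[of p] \<Gamma>_F[of q]
      unfolding \<Gamma>_frac by linarith
    then show False using \<rho> Rats_of_int by metis
  qed
  have d1: "\<bar>d\<bar> = 1"
    by (rule degree_of_injective[of \<gamma> \<Gamma> d, OF assms(2) \<gamma>(1) d \<open>d \<noteq> 0\<close>])
  then have dd: "real_of_int d * real_of_int d = 1"
    by (auto simp: abs_if split: if_splits)
  have inj: "inj \<Gamma>"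
    by (rule inj_lift[of \<gamma> \<Gamma> d, OF assms(2) \<gamma>(1) d \<open>d \<noteq> 0\<close>])
  define h where "h x = frac (inv \<Gamma> (x + \<rho>) - inv \<Gamma> x)" for x
  have h: "h (\<Gamma> y) = step y" for y
  proof -
    have "\<Gamma> (F y + of_int (j * d)) = \<Gamma> y + \<rho>"
      using per[of "F y" "j * d"] \<Gamma>_F[of y] dd by simp
    then have "inv \<Gamma> (\<Gamma> y + \<rho>) = F y + of_int (j * d)"
      using inv_f_f[OF inj, of "F y + of_int (j * d)"] by simp
    then have "h (\<Gamma> y) = frac ((F y + of_int (j * d)) - y)"
      unfolding h_def inv_f_f[OF inj] by simp
    also have "(F y + of_int (j * d)) - y = (F y - y) + of_int (j * d)"
      by linarith
    finally show ?thesis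
      unfolding step_def frac_def floor_add_int[symmetric] by simp
  qed
  have "surj \<Gamma>"
    by (rule surj_of_unit_shift[of \<Gamma> d, OF cont_\<Gamma> d d1])
  then have "h ` {0..1} \<subseteq> range step"
    using h by (metis image_subsetI rangeI surjD)
  moreover have "step y \<in> h ` {0..1}" for y
  proof -
    define i where "i = \<lfloor>\<Gamma> y\<rfloor>"
    have "\<Gamma> (y + of_int (- i * d)) = \<Gamma> y - of_int i"
      using per[of y "- i * d"] dd by simp
    then have "h (\<Gamma> y - of_int i) = step y"
      using h[of "y + of_int (- i * d)"] step_add_of_int by metis
    moreover have "\<Gamma> y - of_int i \<in> {0..1}"
      unfolding i_def atLeastAtMost_iff by linarith
    ultimately show ?thesis by (metis imageI)
  qed
  ultimately show ?thesis unfolding h_def by blast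
qed

end

section \<open>Lift and rotation number of an orientation preserving homeomorphism\<close>

lemma orientation_preserving_lift:
  assumes "orientation_preserving_homeo f" "circle_lift f F"
  shows "degree_one_homeo F"
proof -
  have inj: "inj_on f circle"
    using assms(1) circle_homeo_bij(2) unfolding orientation_preserving_homeo_def bij_betw_def by blast
  obtain G where G: "circle_lift f G" "strict_mono G"
    using assms(1) unfolding orientation_preserving_homeo_def by blast
  obtain k :: int where "\<And>x. F x = G x + of_int k"
    using lift_unique[OF G(1) assms(2)] by blast
  then have mono: "strict_mono F"
    using G(2) by (simp add: strict_mono_def)
  obtain d :: int where d: "\<And>x. F (x + 1) = F x + of_int d"
    using lift_degree[OF assms(2)] by metis
  have "d > 0"
    using d[of 0] strict_monoD[OF mono, of 0 1] by simp
  with degree_of_injective[of f F d, OF assms(2) inj d] have "d = 1" by simp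
  with d mono assms(2) show ?thesis
    unfolding degree_one_homeo_def circle_lift_def by simp
qed

text \<open>
  Passing to the lift \<open>F + k\<close> changes the limit of \<open>F\<^sup>n(x)/n\<close> by the integer \<open>k\<close>, so that the
  description which defines the rotation number is satisfied by one value only.
\<close>
lemma (in degree_one_homeo) rotation_number_eq:
  assumes "circle_lift f F"
  shows "rotation_number f = frac transl"
  unfolding rotation_number_def
proof (rule the_equality)
  show "\<forall>G x. circle_lift f G \<longrightarrow>
      (\<exists>L. (\<lambda>n. (G ^^ n) x / real n) \<longlonglongrightarrow> L \<and> frac transl = frac L)"
  proof (intro allI impI)
    fix G x assume "circle_lift f G"
    then obtain k :: int where G: "\<And>x. G x = F x + of_int k"
      using lift_unique[OF assms] by blast
    have iterate: "(G ^^ n) x = (F ^^ n) x + of_int (int n * k)" for n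
    proof (induction n)
      case (Suc n)
      then show ?case
        using shift_by_int[of F 1 "(F ^^ n) x" "int n * k", OF shift] by (simp add: G algebra_simps)
    qed simp
    have "(\<lambda>n. (F ^^ n) x / real n + of_int k) \<longlonglongrightarrow> transl + of_int k"
      by (intro tendsto_intros transl_limit)
    moreover have "\<forall>\<^sub>F n in sequentially. (F ^^ n) x / real n + of_int k = (G ^^ n) x / real n"
      using eventually_gt_at_top[of 0] by eventually_elim (simp add: iterate add_divide_distrib)
    ultimately have "(\<lambda>n. (G ^^ n) x / real n) \<longlonglongrightarrow> transl + of_int k"
      by (rule Lim_transform_eventually)
    moreover have "frac transl = frac (transl + of_int k)"
      by (simp add: frac_def)
    ultimately show "\<exists>L. (\<lambda>n. (G ^^ n) x / real n) \<longlonglongrightarrow> L \<and> frac transl = frac L"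
      by blast
  qed
next
  fix r assume "\<forall>G x. circle_lift f G \<longrightarrow> (\<exists>L. (\<lambda>n. (G ^^ n) x / real n) \<longlonglongrightarrow> L \<and> r = frac L)"
  with assms obtain L where "(\<lambda>n. (F ^^ n) 0 / real n) \<longlonglongrightarrow> L" "r = frac L"
    by blast
  with transl_limit[of 0] LIMSEQ_unique show "r = frac transl" by blast
qed

section \<open>Density and limits of displacement sequences\<close>

theorem proposition3p1:
  fixes \<phi> :: "complex \<Rightarrow> complex" and \<Phi> :: "real \<Rightarrow> real" and \<rho> :: real
  assumes "orientation_preserving_homeo \<phi>"
    and "rotation_number \<phi> = \<rho>"
    and "\<rho> \<notin> \<rat>"
    and "circle_lift \<phi> \<Phi>"
  shows "(circle_transitive \<phi> \<longrightarrow>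
      (\<forall>z\<in>circle. dense_in_set ((\<lambda>n. displacement \<Phi> n z) ` {1..})
         (min_max_interval (\<lambda>x. frac (\<Phi> x - x)))) \<and>
      (\<exists>\<gamma> \<Gamma>. conjugates_to_rotation \<gamma> \<phi> \<rho> \<and> circle_lift \<gamma> \<Gamma>) \<and>
      (\<forall>\<gamma> \<Gamma>. conjugates_to_rotation \<gamma> \<phi> \<rho> \<and> circle_lift \<gamma> \<Gamma> \<longrightarrow>
         min_max_interval (\<lambda>x. frac (\<Phi> x - x)) =
         min_max_interval (\<lambda>x. frac (inv \<Gamma> (x + \<rho>) - inv \<Gamma> x)))) \<and>
    (\<not> circle_transitive \<phi> \<longrightarrow> (\<forall>\<Delta>. minimal_set \<phi> \<Delta> \<longrightarrow>
      (\<forall>z\<in>\<Delta>. dense_in_set ((\<lambda>n. displacement \<Phi> n z) ` {1..})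
         ((\<lambda>x. frac (\<Phi> x - x)) ` lift01 \<Delta>)) \<and>
      (\<forall>z\<in>circle - \<Delta>. \<forall>w\<in>\<Delta>.
         \<exists>n m :: nat \<Rightarrow> nat. strict_mono n \<and> strict_mono m \<and>
           (\<forall>l::int.
             (\<lambda>k. displacement \<Phi> l (ziter circle \<phi> (int (n k)) z))
               \<longlonglongrightarrow> displacement \<Phi> l w \<and>
             (\<lambda>k. displacement \<Phi> l (ziter circle \<phi> (- int (m k)) z))
               \<longlonglongrightarrow> displacement \<Phi> l w))))"
proof -
  have homeo: "circle_homeo \<phi>"
    using assms(1) unfolding orientation_preserving_homeo_def by blast
  interpret degree_one_homeo \<Phi>
    using orientation_preserving_lift[OF assms(1,4)] .
  have \<rho>: "\<rho> = frac transl"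
    using rotation_number_eq[OF assms(4)] assms(2) by simp
  interpret irrational_circle_homeo \<Phi> \<phi>
  proof unfold_locales
    show "transl \<notin> \<rat>"
      using assms(3) unfolding \<rho> frac_def by (metis Rats_diff Rats_of_int)
  qed (use homeo assms(4) in auto)
  have step: "(\<lambda>x. frac (\<Phi> x - x)) = step"
    by (simp add: step_def fun_eq_iff)
  show ?thesis
    unfolding step
  proof (intro conjI impI allI ballI)
    fix z assume tr: "circle_transitive \<phi>" and "z \<in> circle"
    then obtain x where "z = cover x"
      by (metis circle_coverE)
    moreover have "dense_in_set ((\<lambda>n. displacement \<Phi> n (cover x)) ` {1..}) (range step)" for x
      by (rule displacement_dense[OF transitive_imp_not_flat[OF tr]]) auto
    ultimately show "dense_in_set ((\<lambda>n. displacement \<Phi> n z) ` {1..}) (min_max_interval step)"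
      by (simp add: min_max_interval_step)
  next
    assume "circle_transitive \<phi>"
    then show "\<exists>\<gamma> \<Gamma>. conjugates_to_rotation \<gamma> \<phi> \<rho> \<and> circle_lift \<gamma> \<Gamma>"
      using transitive_imp_conjugate unfolding \<rho> by blast
  next
    fix \<gamma> \<Gamma> assume "conjugates_to_rotation \<gamma> \<phi> \<rho> \<and> circle_lift \<gamma> \<Gamma>"
    then have "(\<lambda>x. frac (inv \<Gamma> (x + \<rho>) - inv \<Gamma> x)) ` {0..1} = range step"
      using conjugate_displacement assms(3) by blast
    then show "min_max_interval step = min_max_interval (\<lambda>x. frac (inv \<Gamma> (x + \<rho>) - inv \<Gamma> x))"
      unfolding min_max_interval_def by (simp add: min_max_interval_step(2))
  next
    fix \<Delta> z assume \<Delta>: "minimal_set \<phi> \<Delta>" and z: "z \<in> \<Delta>"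
    have sub: "\<Delta> \<subseteq> circle" and inv: "\<phi> ` \<Delta> = \<Delta>"
      using \<Delta> unfolding minimal_set_def closed_invariant_def by auto
    obtain x where x: "z = cover x"
      using z sub by (metis circle_coverE subsetD)
    show "dense_in_set ((\<lambda>n. displacement \<Phi> n z) ` {1..}) (step ` lift01 \<Delta>)"
      unfolding x
    proof (rule displacement_dense)
      fix n
      have "(\<phi> ^^ n) z \<in> \<Delta>"
        by (induction n) (use z inv in auto)
      then have "cover (iter (int n) x) \<in> \<Delta>"
        using ziter_cover[of "int n" x] by (simp add: ziter_of_nat x)
      moreover obtain v where "v \<in> {0..<1}" "cover v = cover (iter (int n) x)"
        using cover_image_unit_interval cover_in_circle[of "iter (int n) x"] by (metis imageE)
      ultimately show "\<exists>v\<in>lift01 \<Delta>. cover v = cover (iter (int n) x)"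
        unfolding lift01_def by auto
    qed (use minimal_set_not_flat[OF \<Delta>] in \<open>auto simp: lift01_def\<close>)
  next
    fix \<Delta> z w assume \<Delta>: "minimal_set \<phi> \<Delta>" and z: "z \<in> circle - \<Delta>" and w: "w \<in> \<Delta>"
    have "\<Delta> \<subseteq> circle"
      using \<Delta> unfolding minimal_set_def closed_invariant_def by auto
    with z w obtain x v where x: "z = cover x" and v: "w = cover v"
      by (metis circle_coverE DiffD1 subsetD)
    note approach = displacement_ziter_tendsto[OF minimal_set_not_flat[OF \<Delta> w[unfolded v]], where x = x]
    obtain n where n: "strict_mono n"
      "\<And>l. (\<lambda>k. displacement \<Phi> l (ziter circle \<phi> (1 * int (n k)) z)) \<longlonglongrightarrow> displacement \<Phi> l w"
      using approach[of 1] unfolding x v by auto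
    obtain m where m: "strict_mono m"
      "\<And>l. (\<lambda>k. displacement \<Phi> l (ziter circle \<phi> (- 1 * int (m k)) z)) \<longlonglongrightarrow> displacement \<Phi> l w"
      using approach[of "- 1"] unfolding x v by auto
    show "\<exists>n m :: nat \<Rightarrow> nat. strict_mono n \<and> strict_mono m \<and>
        (\<forall>l::int.
          (\<lambda>k. displacement \<Phi> l (ziter circle \<phi> (int (n k)) z)) \<longlonglongrightarrow> displacement \<Phi> l w \<and>
          (\<lambda>k. displacement \<Phi> l (ziter circle \<phi> (- int (m k)) z)) \<longlonglongrightarrow> displacement \<Phi> l w)"
      using n m by (intro exI[of _ n] exI[of _ m]) simp
  qed
qed

end
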